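(* Let $\mathcal{P}$ be a finite index set and $\{A_p : p\in\mathcal{P}\}$ a collection of real $n\times n$ matrices, each of which is either stable or unstable. Let $\mathcal{G}$ be a directed graph on the subsystems such that its subgraph $\mathcal{G}_u$ is acyclic, and let $\mathbb{M}$ be a nonempty compact set of real $n\times n$ matrices not containing the zero matrix. Then there exist $\tau^*\ge0$, $\eta^*>0$ and a nonempty collection $\mathcal{I}=\{I_q : q\in\mathcal{Q}\}\subseteq\mathbb{M}$ of (nonzero) impulses such that for all switching signals $\sigma\in\mathcal{S}^{\mathcal{G}}[\tau^*,\eta^*]$ the impulsive switched system $\dot x(t)=A_{\sigma(t)}x(t)$, $x(t_k)=I_{\omega(t_k)}\,x(t_k^-)$ ($k\ge1$) is stable under arbitrary impulses, i.e. stable for every function $\omega:\{t_1,t_2,\dots\}\to\mathcal{Q}$.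
   Context: A real matrix is called stable if all its eigenvalues have negative real part, and unstable if at least one eigenvalue has positive real part. A switching signal is a right-continuous piecewise constant function $\sigma:[0,\infty)\to\mathcal{P}$ whose set of discontinuities $\{t_k\}_{k\ge1}$ (switching times) is an increasing sequence with $t_k\uparrow\infty$; put $t_0=0$. Graph: $\mathcal{G}$ is a directed graph with vertices the subsystems $A_p$, identified with $p\in\mathcal{P}$, such that every $p$ has at least one outgoing edge $(p,q)\in\mathcal{E}(\mathcal{G})$. $\mathcal{G}_u$ is the subgraph with the same vertices and with edges $\{(p,q)\in\mathcal{E}(\mathcal{G}) : A_p \text{ unstable}\}$. A signal $\sigma$ is $\mathcal{G}$-admissible if $(\sigma(t_{k-1}),\sigma(t_k))\in\mathcal{E}(\mathcal{G})$ for all $k\ge1$. For $\tau\ge 0$, $\eta>0$, $\mathcal{S}^{\mathcal{G}}[\tau,\eta]$ is the set of $\mathcal{G}$-admissible switching signals such that for all $k\ge1$: $t_k-t_{k-1}\ge\tau$ if $A_{\sigma(t_{k-1})}$ is stable, and $t_k-t_{k-1}\le\eta$ if $A_{\sigma(t_{k-1})}$ is unstable. In the impulsive switched system, $\dot x=A_{\sigma(t)}x$ holds on each $[t_{k-1},t_k)$ and $x(t_k^-)=\lim_{t\to t_k^-}x(t)$. The system (for fixed $\sigma,\omega$) is stable if for every $\epsilon>0$ there is $\delta>0$ such that $\|x(0)\|<\delta$ implies $\|x(t)\|<\epsilon$ for all $t>0$ (Euclidean norm). *)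

theory Defs
  imports "HOL-Analysis.Analysis"
begin

definition complex_matrix :: "real ^ 'n ^ 'm \<Rightarrow> complex ^ 'n ^ 'm" where
  "complex_matrix A = (\<chi> i j. complex_of_real (A $ i $ j))"

definition eigenvalue :: "real ^ 'n ^ 'n \<Rightarrow> complex \<Rightarrow> bool" where
  "eigenvalue A l \<longleftrightarrow> (\<exists>v. v \<noteq> 0 \<and> complex_matrix A *v v = l *s v)"

definition stable_matrix :: "real ^ 'n ^ 'n \<Rightarrow> bool" where
  "stable_matrix A \<longleftrightarrow> (\<forall>l. eigenvalue A l \<longrightarrow> Re l < 0)"

definition unstable_matrix :: "real ^ 'n ^ 'n \<Rightarrow> bool" where
  "unstable_matrix A \<longleftrightarrow> (\<exists>l. eigenvalue A l \<and> Re l > 0)"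

text \<open>
  A signal is a function on \<open>[0,\<infinity>)\<close>; its values at negative arguments are irrelevant. The
  index set carries no topology, so continuity at a point means being locally constant there.
\<close>

definition discontinuities :: "(real \<Rightarrow> 'p) \<Rightarrow> real set" where
  "discontinuities \<sigma> = {s. 0 \<le> s \<and> \<not> (\<forall>\<^sub>F r in at s within {0..}. \<sigma> r = \<sigma> s)}"

text \<open>
  \<open>t 0 = 0\<close> and \<open>t 1, t 2, \<dots>\<close> are the switching times of \<open>\<sigma>\<close>; the sequence \<open>t\<close> is uniquely
  determined by \<open>\<sigma>\<close>. Being constant on the half-open intervals \<open>[t k, t (Suc k))\<close> expresses
  right-continuity together with piecewise constancy.
\<close>

definition switching_signal :: "'p set \<Rightarrow> (real \<Rightarrow> 'p) \<Rightarrow> (nat \<Rightarrow> real) \<Rightarrow> bool" where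
  "switching_signal P \<sigma> t \<longleftrightarrow>
     (\<forall>s\<ge>0. \<sigma> s \<in> P) \<and>
     t 0 = 0 \<and> strict_mono t \<and> filterlim t at_top sequentially \<and>
     discontinuities \<sigma> = t ` {1..} \<and>
     (\<forall>k. \<forall>s\<in>{t k..<t (Suc k)}. \<sigma> s = \<sigma> (t k))"

text \<open>
  The graph is given by its edge relation \<open>E\<close> on the index set.
\<close>

definition unstable_edges :: "('p \<Rightarrow> real ^ 'n ^ 'n) \<Rightarrow> ('p \<times> 'p) set \<Rightarrow> ('p \<times> 'p) set" where
  "unstable_edges A E = {(p, q) \<in> E. unstable_matrix (A p)}"

definition graph_admissible :: "('p \<times> 'p) set \<Rightarrow> (real \<Rightarrow> 'p) \<Rightarrow> (nat \<Rightarrow> real) \<Rightarrow> bool" where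
  "graph_admissible E \<sigma> t \<longleftrightarrow> (\<forall>k\<ge>1. (\<sigma> (t (k - 1)), \<sigma> (t k)) \<in> E)"

text \<open>
  The class \<open>S[\<tau>, \<eta>]\<close>; each signal is paired with its sequence of switching times.
\<close>

definition signal_class ::
  "'p set \<Rightarrow> ('p \<times> 'p) set \<Rightarrow> ('p \<Rightarrow> real ^ 'n ^ 'n) \<Rightarrow> real \<Rightarrow> real
     \<Rightarrow> ((real \<Rightarrow> 'p) \<times> (nat \<Rightarrow> real)) set" where
  "signal_class P E A \<tau> \<eta> =
     {(\<sigma>, t). switching_signal P \<sigma> t \<and> graph_admissible E \<sigma> t \<and>
        (\<forall>k\<ge>1.
           (stable_matrix (A (\<sigma> (t (k - 1)))) \<longrightarrow> t k - t (k - 1) \<ge> \<tau>) \<and>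
           (unstable_matrix (A (\<sigma> (t (k - 1)))) \<longrightarrow> t k - t (k - 1) \<le> \<eta>))}"

text \<open>
  Trajectories of the impulsive switched system. On \<open>[t (k - 1), t k)\<close> the derivative is taken
  within that interval, so it is the right derivative at \<open>t (k - 1)\<close>. The vector \<open>y\<close> is the
  left limit of \<open>x\<close> at \<open>t k\<close>.
\<close>

definition trajectory ::
  "('p \<Rightarrow> real ^ 'n ^ 'n) \<Rightarrow> ('q \<Rightarrow> real ^ 'n ^ 'n) \<Rightarrow> (real \<Rightarrow> 'p) \<Rightarrow> (nat \<Rightarrow> real)
     \<Rightarrow> (real \<Rightarrow> 'q) \<Rightarrow> (real \<Rightarrow> real ^ 'n) \<Rightarrow> bool" where
  "trajectory A I \<sigma> t \<omega> x \<longleftrightarrow>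
     (\<forall>k\<ge>1. \<forall>s\<in>{t (k - 1)..<t k}.
        (x has_vector_derivative A (\<sigma> s) *v x s) (at s within {t (k - 1)..<t k})) \<and>
     (\<forall>k\<ge>1. \<exists>y. (x \<longlongrightarrow> y) (at_left (t k)) \<and> x (t k) = I (\<omega> (t k)) *v y)"

definition stable_system ::
  "('p \<Rightarrow> real ^ 'n ^ 'n) \<Rightarrow> ('q \<Rightarrow> real ^ 'n ^ 'n) \<Rightarrow> (real \<Rightarrow> 'p) \<Rightarrow> (nat \<Rightarrow> real)
     \<Rightarrow> (real \<Rightarrow> 'q) \<Rightarrow> bool" where
  "stable_system A I \<sigma> t \<omega> \<longleftrightarrow>
     (\<forall>\<epsilon>>0. \<exists>\<delta>>0. \<forall>x. trajectory A I \<sigma> t \<omega> x \<longrightarrow> norm (x 0) < \<delta> \<longrightarrow>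
        (\<forall>s>0. norm (x s) < \<epsilon>))"

end

theory Submission
  imports Defs "HOL-Computational_Algebra.Fundamental_Theorem_Algebra"
begin

text \<open>
  Take all of \<open>M\<close> as the impulses, and \<open>\<eta> = 1\<close>. With a uniform constant \<open>G\<close>, one period followed by
  an impulse multiplies the norm by at most \<open>G\<close>, and by at most \<open>G * exp (- \<mu> * \<tau>)\<close> if the
  subsystem is stable. Acyclicity gives a rank \<open>h \<le> N\<close> on the index set that decreases along
  unstable edges; for \<open>G ^ Suc N \<le> exp (\<mu> * \<tau>)\<close> the potential
  \<open>norm (x (t k)) * G ^ h (\<sigma> (t k))\<close> is nonincreasing in \<open>k\<close>, which bounds the whole trajectory
  by a constant multiple of \<open>norm (x 0)\<close>.

  Exponential decay for a stable matrix needs neither the matrix exponential nor a normal form: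
  a product of factors \<open>B - l\<close> over eigenvalues \<open>l\<close> vanishes, and along a solution the iterates
  \<open>y, (B - l\<^sub>1) y, (B - l\<^sub>2) (B - l\<^sub>1) y, \<dots>\<close> satisfy a triangular system ending in \<open>0\<close>, for which a
  weighted sum of squared norms is a Lyapunov function.
\<close>

section \<open>Annihilating products of linear factors\<close>

text \<open>The operator \<open>B - l\<close>, kept as a map on vectors so that a product of such
  factors becomes a \<open>fold\<close> over a list.\<close>

definition shift :: "complex ^ 'n ^ 'n \<Rightarrow> complex \<Rightarrow> complex ^ 'n \<Rightarrow> complex ^ 'n" where
  "shift B l v = B *v v - l *s v"

text \<open>This is p(B) v. Powers of \<open>B\<close> are iterates of a map, because the built-in
  product on the vector type is componentwise.\<close>

definition poly_action :: "complex ^ 'n ^ 'n \<Rightarrow> complex poly \<Rightarrow> complex ^ 'n \<Rightarrow> complex ^ 'n" where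
  "poly_action B p v = (\<Sum>i\<le>degree p. coeff p i *s (((*v) B ^^ i) v))"

lemma shift_eq_0_iff: "shift B l v = 0 \<longleftrightarrow> B *v v = l *s v"
  by (simp add: shift_def)

lemma shift_shift_commute: "shift B l (shift B m v) = shift B m (shift B l v)"
  by (simp add: shift_def algebra_simps vector_scalar_commute vector_ssub_ldistrib vector_smult_assoc)

lemma matrix_shift_commute: "B *v shift B l v = shift B l (B *v v)"
  by (simp add: shift_def algebra_simps vector_scalar_commute)

text \<open>The factors commute, being polynomials in \<open>B\<close>. As \<open>fold\<close>
  applies the head of the list first, this moves a factor from the innermost to the outermost
  place.\<close>

lemma fold_shift_commute: "fold (shift B) ls (shift B l v) = shift B l (fold (shift B) ls v)"
proof (induction ls arbitrary: v)
  case (Cons m ls)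
  have "fold (shift B) (m # ls) (shift B l v) = fold (shift B) ls (shift B l (shift B m v))"
    by (simp add: shift_shift_commute)
  then show ?case by (simp add: Cons)
qed simp

lemma bounded_linear_shift: "bounded_linear (shift B l)"
proof -
  have "bounded_linear (\<lambda>v. l *s v)"
    unfolding linear_conv_bounded_linear[symmetric]
    by (rule linearI) (simp_all add: vec_eq_iff algebra_simps)
  then show ?thesis
    unfolding shift_def by (intro bounded_linear_sub matrix_vector_mul_bounded_linear)
qed

text \<open>Padding with zero coefficients gives polynomials of different degrees a common range of
  summation.\<close>

lemma poly_action_eq_sum:
  assumes "degree p \<le> N"
  shows "poly_action B p v = (\<Sum>i\<le>N. coeff p i *s (((*v) B ^^ i) v))"
  unfolding poly_action_def
  using assms by (intro sum.mono_neutral_left) (auto simp: coeff_eq_0)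

lemma poly_action_add: "poly_action B (p + q) v = poly_action B p v + poly_action B q v"
proof -
  define N where "N = max (degree p) (degree q)"
  have "degree (p + q) \<le> N" "degree p \<le> N" "degree q \<le> N"
    by (auto simp: N_def degree_add_le_max)
  then show ?thesis
    by (simp add: poly_action_eq_sum[of _ N] vector_sadd_rdistrib sum.distrib)
qed

lemma poly_action_smult: "poly_action B (smult c p) v = c *s poly_action B p v"
  by (simp add: poly_action_eq_sum[of _ "degree p"] degree_smult_le vec.scale_sum_right
      vector_smult_assoc)

lemma poly_action_pCons_0: "poly_action B (pCons 0 p) v = B *v poly_action B p v"
proof -
  have "poly_action B (pCons 0 p) v = (\<Sum>i\<le>Suc (degree p). coeff (pCons 0 p) i *s (((*v) B ^^ i) v))"
    by (rule poly_action_eq_sum) (rule degree_pCons_le)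
  also have "\<dots> = (\<Sum>i\<le>degree p. coeff p i *s (B *v (((*v) B ^^ i) v)))"
    by (simp only: sum.atMost_Suc_shift) simp
  also have "\<dots> = B *v poly_action B p v"
    unfolding poly_action_def matrix_vector_right_distrib
    by (simp add: linear_sum[OF matrix_vector_mul_linear] vector_scalar_commute)
  finally show ?thesis .
qed

lemma poly_action_linear_mult: "poly_action B ([:- l, 1:] * q) v = shift B l (poly_action B q v)"
proof -
  have "[:- l, 1:] * q = smult (- l) q + pCons 0 q"
    by (simp add: mult_pCons_left)
  then show ?thesis
    by (simp add: poly_action_add poly_action_smult poly_action_pCons_0 shift_def vector_smult_lneg
        del: mult_pCons_left smult_minus_left)
qed

text \<open>The product has its head factor outermost, while \<open>fold\<close> applies the head
  first; commutation reconciles the two orders.\<close>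

lemma poly_action_prod_list:
  "poly_action B (\<Prod>l\<leftarrow>ls. [:- l, 1:]) v = fold (shift B) ls v"
proof (induction ls arbitrary: v)
  case Nil
  then show ?case by (simp add: poly_action_def)
next
  case (Cons l ls)
  then show ?case
    by (simp add: poly_action_linear_mult fold_shift_commute del: mult_pCons_left)
qed

section \<open>Existence of annihilating products over eigenvalues\<close>

lemma sequence_linearly_dependent:
  fixes f :: "nat \<Rightarrow> 'a::euclidean_space"
  obtains c :: "nat \<Rightarrow> real" and N k where "k \<le> N" "c k \<noteq> 0" "(\<Sum>i\<le>N. c i *\<^sub>R f i) = 0"
\<comment> \<open>Dependence is a property of sets, hence the case split: \<open>DIM('a) + 1\<close>
  distinct vectors are too many to be independent, and two equal terms yield their difference as the
  relation.\<close>
proof (cases "inj_on f {..DIM('a)}")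
  case True
  then have "card (f ` {..DIM('a)}) > DIM('a)"
    by (simp add: card_image)
  then have "dependent (f ` {..DIM('a)})"
    by (intro dependent_biggerset)
  then obtain u v where uv: "v \<in> f ` {..DIM('a)}" "u v \<noteq> 0"
      "(\<Sum>v\<in>f ` {..DIM('a)}. u v *\<^sub>R v) = 0"
    by (subst (asm) dependent_finite) auto
  then obtain k where "k \<le> DIM('a)" "v = f k" by auto
  moreover have "(\<Sum>i\<le>DIM('a). u (f i) *\<^sub>R f i) = 0"
    using uv(3) sum.reindex[OF True, of "\<lambda>v. u v *\<^sub>R v"] by simp
  ultimately show ?thesis
    using uv that[of k "DIM('a)" "\<lambda>i. u (f i)"] by simp
next
  case False
  then obtain i j where ij: "i \<le> DIM('a)" "j \<le> DIM('a)" "i \<noteq> j" "f i = f j"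
    by (auto simp: inj_on_def)
  define c :: "nat \<Rightarrow> real" where "c m = (if m = i then 1 else 0) - (if m = j then 1 else 0)" for m
  have "(\<Sum>m\<le>DIM('a). c m *\<^sub>R f m) =
      (\<Sum>m\<le>DIM('a). if m = i then f m else 0) - (\<Sum>m\<le>DIM('a). if m = j then f m else 0)"
    unfolding sum_subtractf[symmetric] by (intro sum.cong) (auto simp: c_def)
  also have "\<dots> = 0" using ij by simp
  finally show ?thesis using that[of i "DIM('a)" c] ij by (simp add: c_def)
qed

text \<open>The powers of \<open>B\<close> lie in a real vector space of finite dimension, so a
  nontrivial real combination of them vanishes; it supplies the coefficients of
  \<open>p\<close>.\<close>

lemma annihilating_polynomial:
  fixes B :: "complex ^ 'n ^ 'n"
  obtains p where "p \<noteq> 0" "\<And>v. poly_action B p v = 0"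
proof -
  define X where "X i = (((**) B) ^^ i) (mat 1)" for i
  have X: "X i *v v = ((*v) B ^^ i) v" for i v
    by (induction i) (simp_all add: X_def matrix_vector_mul_assoc[symmetric])
  obtain c :: "nat \<Rightarrow> real" and N k where c: "k \<le> N" "c k \<noteq> 0" "(\<Sum>i\<le>N. c i *\<^sub>R X i) = 0"
    by (rule sequence_linearly_dependent)
  define p where "p = (\<Sum>i\<le>N. monom (complex_of_real (c i)) i)"
  have coeff: "coeff p i = (if i \<le> N then complex_of_real (c i) else 0)" for i
    by (simp add: p_def coeff_sum if_distrib cong: if_cong)
  have "p \<noteq> 0"
    using c(1,2) coeff[of k] by auto
  moreover have "poly_action B p v = 0" for v
  proof -
    have "degree p \<le> N"
      by (rule degree_le) (simp add: coeff)
    then have "poly_action B p v = (\<Sum>i\<le>N. (c i *\<^sub>R X i) *v v)"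
      by (simp add: poly_action_eq_sum coeff X[symmetric] vec_eq_iff matrix_vector_mult_def
          sum_distrib_left scaleR_conv_of_real[where 'a = complex] mult.assoc)
    also have "\<dots> = (\<Sum>i\<le>N. c i *\<^sub>R X i) *v v"
      by (simp add: vec_eq_iff matrix_vector_mult_def sum_distrib_right sum.swap[of _ _ UNIV])
    also have "\<dots> = 0" using c(3) by simp
    finally show ?thesis .
  qed
  ultimately show ?thesis by (rule that)
qed

text \<open>If \<open>l\<close> is not an eigenvalue, then \<open>B - l\<close> is injective, so its
  factor can be moved outermost and cancelled.\<close>

lemma fold_shift_filter_eigenvalues:
  assumes "fold (shift B) ls v = 0"
  shows "fold (shift B) (filter (\<lambda>l. \<exists>w. w \<noteq> 0 \<and> B *v w = l *s w) ls) v = 0"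
  using assms
proof (induction ls arbitrary: v)
  case (Cons l ls)
  then have "shift B l (fold (shift B) ls v) = 0"
    by (simp add: fold_shift_commute)
  with Cons show ?case
    by (auto simp: shift_eq_0_iff)
qed simp

text \<open>An annihilating polynomial splits into linear factors over the complex numbers. Its
  nonzero leading coefficient cancels, and so do the factors whose roots are not
  eigenvalues.\<close>

lemma annihilating_eigenvalue_product:
  fixes B :: "complex ^ 'n ^ 'n"
  obtains ls where "\<And>l. l \<in> set ls \<Longrightarrow> \<exists>w. w \<noteq> 0 \<and> B *v w = l *s w"
    and "\<And>v. fold (shift B) ls v = 0"
proof -
  obtain p where p: "p \<noteq> 0" "\<And>v. poly_action B p v = 0"
    using annihilating_polynomial[of B] by blast
  obtain R where R: "p = smult (lead_coeff p) (\<Prod>x\<in>#R. [:- x, 1:])"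
    using alg_closed_imp_factorization[OF p(1)] by auto
  obtain ls where "R = mset ls"
    using ex_mset[of R] by auto
  then have "p = smult (lead_coeff p) (\<Prod>l\<leftarrow>ls. [:- l, 1:])"
    using R by (metis mset_map prod_mset_prod_list)
  then have "lead_coeff p *s fold (shift B) ls v = 0" for v
    using p(2)[of v] by (metis poly_action_prod_list poly_action_smult)
  then have "fold (shift B) ls v = 0" for v
    using p(1) by simp
  then show ?thesis
    using that[of "filter (\<lambda>l. \<exists>w. w \<noteq> 0 \<and> B *v w = l *s w) ls"]
    by (simp add: fold_shift_filter_eigenvalues)
qed

section \<open>A Lyapunov function for stable matrices\<close>

text \<open>The sum of \<open>c ^ i\<close> times the squared norm of v_i for i below the length of
  the list, where v_0 = v and v_(i+1) arises from v_i by the next factor.\<close>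

fun lyapunov :: "complex ^ 'n ^ 'n \<Rightarrow> real \<Rightarrow> complex list \<Rightarrow> complex ^ 'n \<Rightarrow> real" where
  "lyapunov B c [] v = 0"
| "lyapunov B c (l # ls) v = (norm v)\<^sup>2 + c * lyapunov B c ls (shift B l v)"

fun lyapunov_deriv :: "complex ^ 'n ^ 'n \<Rightarrow> real \<Rightarrow> complex list \<Rightarrow> complex ^ 'n \<Rightarrow> real" where
  "lyapunov_deriv B c [] v = 0"
| "lyapunov_deriv B c (l # ls) v =
     2 * (v \<bullet> (B *v v)) + c * lyapunov_deriv B c ls (shift B l v)"

lemma lyapunov_nonneg: "c \<ge> 0 \<Longrightarrow> lyapunov B c ls v \<ge> 0"
  by (induction ls arbitrary: v) auto

text \<open>For the empty list the vanishing hypothesis reads \<open>v = 0\<close>; otherwise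
  \<open>(norm v)\<^sup>2\<close> is the first summand and the rest is nonnegative.\<close>

lemma norm_le_lyapunov:
  assumes "c \<ge> 0" "fold (shift B) ls v = 0"
  shows "(norm v)\<^sup>2 \<le> lyapunov B c ls v"
  using assms by (cases ls) (auto simp: lyapunov_nonneg)

lemma lyapunov_le_norm:
  assumes "c \<ge> 0"
  obtains K where "K \<ge> 0" "\<And>v. lyapunov B c ls v \<le> K * (norm v)\<^sup>2"
proof -
  have "\<exists>K\<ge>0. \<forall>v. lyapunov B c ls v \<le> K * (norm v)\<^sup>2"
  proof (induction ls)
    case (Cons l ls)
    then obtain K where K: "K \<ge> 0" "\<And>v. lyapunov B c ls v \<le> K * (norm v)\<^sup>2" by auto
    obtain L where L: "\<And>v. norm (shift B l v) \<le> norm v * L"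
      using bounded_linear.bounded[OF bounded_linear_shift] by blast
    have "lyapunov B c (l # ls) v \<le> (1 + c * (K * L\<^sup>2)) * (norm v)\<^sup>2" for v
    proof -
      have "lyapunov B c ls (shift B l v) \<le> K * (norm (shift B l v))\<^sup>2" by (rule K)
      also have "\<dots> \<le> K * (norm v * L)\<^sup>2"
        using L by (intro mult_left_mono power_mono K) auto
      finally have "c * lyapunov B c ls (shift B l v) \<le> c * (K * (norm v * L)\<^sup>2)"
        using assms by (rule mult_left_mono)
      then show ?thesis by (simp add: algebra_simps)
    qed
    moreover have "1 + c * (K * L\<^sup>2) \<ge> 0" using assms K by simp
    ultimately show ?case by blast
  qed auto
  then show ?thesis using that by blast
qed

lemma has_real_derivative_norm_squared:
  fixes x :: "real \<Rightarrow> 'a::real_inner"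
  assumes "(x has_vector_derivative x') (at s within S)"
  shows "((\<lambda>r. (norm (x r))\<^sup>2) has_real_derivative 2 * (x s \<bullet> x')) (at s within S)"
proof -
  have "((\<lambda>r. x r \<bullet> x r) has_derivative (\<lambda>h. x s \<bullet> (h *\<^sub>R x') + (h *\<^sub>R x') \<bullet> x s)) (at s within S)"
    using assms unfolding has_vector_derivative_def by (intro has_derivative_inner)
  then show ?thesis
    unfolding has_field_derivative_def power2_norm_eq_inner
    by (rule has_derivative_eq_rhs) (simp add: fun_eq_iff inner_commute)
qed

text \<open>Since \<open>B\<close> commutes with each factor, the shifted path satisfies the same
  differential equation, so the induction hypothesis applies to it.\<close>

lemma lyapunov_has_real_derivative:
  assumes "(x has_vector_derivative B *v x s) (at s within S)"
  shows "((\<lambda>r. lyapunov B c ls (x r)) has_real_derivative lyapunov_deriv B c ls (x s)) (at s within S)"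
  using assms
proof (induction ls arbitrary: x)
  case (Cons l ls)
  have "((\<lambda>r. shift B l (x r)) has_vector_derivative shift B l (B *v x s)) (at s within S)"
    using Cons.prems by (rule bounded_linear.has_vector_derivative[OF bounded_linear_shift])
  then have "((\<lambda>r. lyapunov B c ls (shift B l (x r))) has_real_derivative
      lyapunov_deriv B c ls (shift B l (x s))) (at s within S)"
    by (intro Cons.IH) (simp add: matrix_shift_commute)
  from DERIV_add[OF has_real_derivative_norm_squared[OF Cons.prems] DERIV_cmult[OF this, of c]]
  show ?case by simp
qed simp

text \<open>The inner product is the real one, that is, the real part of the Hermitian product;
  hence only \<open>Re l\<close> survives. This is how the sign of the real parts of eigenvalues
  enters.\<close>

lemma inner_complex_scale: "(v :: complex ^ 'n) \<bullet> (l *s v) = Re l * (norm v)\<^sup>2"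
proof -
  have "(v :: complex ^ 'n) \<bullet> (l *s v) = (\<Sum>i\<in>UNIV. Re l * (v $ i \<bullet> v $ i))"
    unfolding inner_vec_def by (intro sum.cong) (auto simp: inner_complex_def algebra_simps)
  then show ?thesis
    by (simp add: power2_norm_eq_inner inner_vec_def sum_distrib_left)
qed

text \<open>The extra term \<open>(norm v)\<^sup>2\<close> on the right absorbs, one level up, the cross term
  \<open>2 * (v \<bullet> shift B l v)\<close>; the weight \<open>c = 2 / \<mu>\<^sup>2\<close> is what makes this balance.\<close>

lemma lyapunov_deriv_le:
  fixes B :: "complex ^ 'n ^ 'n"
  assumes "\<mu> > 0" "\<And>l. l \<in> set ls \<Longrightarrow> Re l \<le> - \<mu>" "fold (shift B) ls v = 0"
  shows "lyapunov_deriv B (2 / \<mu>\<^sup>2) ls v \<le> - (\<mu> / 2) * (lyapunov B (2 / \<mu>\<^sup>2) ls v + (norm v)\<^sup>2)"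
  using assms(2,3)
proof (induction ls arbitrary: v)
  case (Cons l ls)
  define y where "y = shift B l v"
  define W where "W = lyapunov B (2 / \<mu>\<^sup>2) ls y"
  define D where "D = lyapunov_deriv B (2 / \<mu>\<^sup>2) ls y"
  have IH: "D \<le> - (\<mu> / 2) * (W + (norm y)\<^sup>2)"
    unfolding D_def W_def using Cons.prems by (intro Cons.IH) (auto simp: y_def)
  have "(2 / \<mu>\<^sup>2) * D \<le> (2 / \<mu>\<^sup>2) * (- (\<mu> / 2) * (W + (norm y)\<^sup>2))"
    using IH by (intro mult_left_mono) auto
  also have "\<dots> = - (\<mu> / 2) * ((2 / \<mu>\<^sup>2) * W) - (norm y)\<^sup>2 / \<mu>"
    using assms(1) by (simp add: field_simps power2_eq_square)
  finally have D: "(2 / \<mu>\<^sup>2) * D \<le> - (\<mu> / 2) * ((2 / \<mu>\<^sup>2) * W) - (norm y)\<^sup>2 / \<mu>" .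
  have "B *v v = l *s v + y" by (simp add: y_def shift_def)
  then have "v \<bullet> (B *v v) = Re l * (norm v)\<^sup>2 + v \<bullet> y"
    by (simp add: inner_add_right inner_complex_scale)
  moreover have "Re l * (norm v)\<^sup>2 \<le> - \<mu> * (norm v)\<^sup>2"
    using Cons.prems by (intro mult_right_mono) auto
  \<comment> \<open>Young's inequality weighted by \<open>\<mu>\<close>. Its term in
    \<open>y\<close> is exactly what the bound \<open>D\<close> compensates.\<close>
  moreover have "2 * (v \<bullet> y) \<le> \<mu> * (norm v)\<^sup>2 + (norm y)\<^sup>2 / \<mu>"
  proof -
    have "0 \<le> (\<mu> * norm v - norm y)\<^sup>2 / \<mu>" using assms(1) by simp
    also have "\<dots> = \<mu> * (norm v)\<^sup>2 + (norm y)\<^sup>2 / \<mu> - 2 * (norm v * norm y)"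
      using assms(1) by (simp add: field_simps power2_eq_square)
    finally show ?thesis using norm_cauchy_schwarz[of v y] by linarith
  qed
  ultimately have "2 * (v \<bullet> (B *v v)) \<le> - \<mu> * (norm v)\<^sup>2 + (norm y)\<^sup>2 / \<mu>" by linarith
  with D have "2 * (v \<bullet> (B *v v)) + (2 / \<mu>\<^sup>2) * D \<le> - \<mu> * (norm v)\<^sup>2 - (\<mu> / 2) * ((2 / \<mu>\<^sup>2) * W)"
    by linarith
  \<comment> \<open>One half of \<open>\<mu> * (norm v)\<^sup>2\<close> goes to the first summand of
    the Lyapunov function, the other half to the extra term.\<close>
  also have "\<dots> = - (\<mu> / 2) * (((norm v)\<^sup>2 + (2 / \<mu>\<^sup>2) * W) + (norm v)\<^sup>2)"
    by (simp add: algebra_simps)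
  finally show ?case by (simp add: D_def W_def y_def)
qed simp

section \<open>Growth estimates for linear systems\<close>

text \<open>The integrating factor \<open>exp (- c * r)\<close> makes the function nonincreasing, by
  the mean value theorem on the closed interval from \<open>a\<close> to \<open>s\<close>. The
  constant \<open>c\<close> may have either sign: positive for growth, negative for decay.\<close>

lemma gronwall:
  fixes f :: "real \<Rightarrow> real"
  assumes deriv: "\<And>r. r \<in> {a..<b} \<Longrightarrow> (f has_real_derivative f' r) (at r within {a..<b})"
    and le: "\<And>r. r \<in> {a..<b} \<Longrightarrow> f' r \<le> c * f r"
    and s: "s \<in> {a..<b}"
  shows "f s \<le> exp (c * (s - a)) * f a"
proof -
  define g where "g r = exp (- c * r) * f r" for r
  define g' where "g' r = exp (- c * r) * (f' r - c * f r)" for r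
  have "(g has_derivative (\<lambda>h. g' r * h)) (at r within {a..s})" if "a \<le> r" "r \<le> s" for r
  proof -
    have "(f has_real_derivative f' r) (at r within {a..s})"
      using that s by (intro DERIV_subset[OF deriv]) auto
    then have "(g has_real_derivative g' r) (at r within {a..s})"
      unfolding g_def g'_def by (auto intro!: derivative_eq_intros simp: algebra_simps)
    then show ?thesis by (simp add: has_field_derivative_def)
  qed
  then have "\<exists>r\<in>{a..s}. g s - g a = g' r * (s - a)"
    using s by (intro mvt_very_simple) auto
  then obtain r where r: "r \<in> {a..s}" "g s - g a = g' r * (s - a)" ..
  have "g' r \<le> 0"
    using le[of r] r(1) s by (auto simp: g'_def mult_le_0_iff)
  then have "g s \<le> g a"
    using r s mult_nonpos_nonneg[of "g' r" "s - a"] by auto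
  then have "exp (c * s) * g s \<le> exp (c * s) * g a" by simp
  moreover have "exp (c * s) * g r = exp (c * (s - r)) * f r" for r
    by (simp add: g_def exp_diff exp_minus right_diff_distrib divide_inverse)
  ultimately show ?thesis by simp
qed

text \<open>The half-open interval matches one period between switches: a right derivative at
  \<open>a\<close>, and no condition at \<open>b\<close>, where an impulse may act.\<close>

definition solves_linear :: "real ^ 'n ^ 'n \<Rightarrow> real \<Rightarrow> real \<Rightarrow> (real \<Rightarrow> real ^ 'n) \<Rightarrow> bool" where
  "solves_linear A a b x \<longleftrightarrow>
     (\<forall>s\<in>{a..<b}. (x has_vector_derivative A *v x s) (at s within {a..<b}))"

text \<open>Gronwall is applied to the squared norm, which unlike the norm is differentiable at the
  origin. Bounding the elapsed time by 1 makes the constant independent of the solution.\<close>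

lemma linear_growth:
  fixes A :: "real ^ 'n ^ 'n"
  obtains C where "C \<ge> 1"
    "\<And>a b x s. solves_linear A a b x \<Longrightarrow> s \<in> {a..<b} \<Longrightarrow> s - a \<le> 1 \<Longrightarrow> norm (x s) \<le> C * norm (x a)"
proof -
  obtain L where L: "L > 0" "\<And>v. norm (A *v v) \<le> norm v * L"
    using bounded_linear.pos_bounded[OF matrix_vector_mul_bounded_linear[of A]] by auto
  have "norm (x s) \<le> exp L * norm (x a)"
    if x: "solves_linear A a b x" and s: "s \<in> {a..<b}" and "s - a \<le> 1" for a b x s
  proof -
    have "2 * (v \<bullet> (A *v v)) \<le> (2 * L) * (norm v)\<^sup>2" for v
    proof -
      have "v \<bullet> (A *v v) \<le> norm v * norm (A *v v)" by (rule norm_cauchy_schwarz)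
      also have "\<dots> \<le> norm v * (norm v * L)" by (intro mult_left_mono L) simp
      finally show ?thesis by (simp add: power2_eq_square algebra_simps)
    qed
    then have "(norm (x s))\<^sup>2 \<le> exp ((2 * L) * (s - a)) * (norm (x a))\<^sup>2"
      using x s unfolding solves_linear_def
      by (intro gronwall[of a b _ "\<lambda>r. 2 * (x r \<bullet> (A *v x r))"] has_real_derivative_norm_squared) auto
    also have "\<dots> \<le> exp (2 * L) * (norm (x a))\<^sup>2"
      using that L by (intro mult_right_mono) (auto simp: mult_left_le)
    also have "\<dots> = (exp L * norm (x a))\<^sup>2"
      by (simp add: power_mult_distrib exp_double)
    finally show ?thesis by (rule power2_le_imp_le) simp
  qed
  then show ?thesis using that[of "exp L"] L by simp
qed

lemma uniform_negative_bound:
  assumes "finite S" "\<And>l. l \<in> S \<Longrightarrow> Re l < 0"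
  obtains \<mu> where "\<mu> > 0" "\<And>l. l \<in> S \<Longrightarrow> Re l \<le> - \<mu>"
proof
  \<comment> \<open>The inserted 1 keeps the minimum defined and positive when \<open>S\<close> is
    empty.\<close>
  let ?T = "insert 1 ((\<lambda>l. - Re l) ` S)"
  show "Min ?T > 0" using assms by (subst Min_gr_iff) auto
  show "Re l \<le> - Min ?T" if "l \<in> S" for l
  proof -
    have "Min ?T \<le> - Re l" using assms(1) that by (intro Min_le) auto
    then show ?thesis by simp
  qed
qed

text \<open>The Lyapunov function of the complexified system lies between the squared norm and a
  multiple of it, and it decays exponentially along solutions.\<close>

lemma stable_matrix_decay:
  fixes A :: "real ^ 'n ^ 'n"
  assumes "stable_matrix A"
  obtains C \<mu> where "C \<ge> 1" "\<mu> > 0"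
    "\<And>a b x s. solves_linear A a b x \<Longrightarrow> s \<in> {a..<b} \<Longrightarrow>
       norm (x s) \<le> C * exp (- \<mu> * (s - a)) * norm (x a)"
proof -
  define B where "B = complex_matrix A"
  obtain ls where eig: "\<And>l. l \<in> set ls \<Longrightarrow> \<exists>w. w \<noteq> 0 \<and> B *v w = l *s w"
    and ann: "\<And>v. fold (shift B) ls v = 0"
    using annihilating_eigenvalue_product[of B] by blast
  have "Re l < 0" if "l \<in> set ls" for l
    using assms eig[OF that] by (auto simp: stable_matrix_def eigenvalue_def B_def)
  then obtain \<mu> where \<mu>: "\<mu> > 0" "\<And>l. l \<in> set ls \<Longrightarrow> Re l \<le> - \<mu>"
    using uniform_negative_bound[of "set ls"] by blast
  define c where "c = 2 / \<mu>\<^sup>2"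
  have c: "c \<ge> 0" by (simp add: c_def)
  then obtain K where K: "K \<ge> 0" "\<And>v. lyapunov B c ls v \<le> K * (norm v)\<^sup>2"
    using lyapunov_le_norm[of c B ls] by blast
  \<comment> \<open>The embedding of real vectors into complex ones preserves norms and intertwines
    \<open>A\<close> with \<open>B\<close>.\<close>
  define z :: "real ^ 'n \<Rightarrow> complex ^ 'n" where "z v = (\<chi> i. complex_of_real (v $ i))" for v
  have z_norm: "norm (z v) = norm v" for v
    by (simp add: z_def norm_vec_def)
  have z_linear: "bounded_linear z"
    unfolding linear_conv_bounded_linear[symmetric]
    by (rule linearI) (simp_all add: z_def vec_eq_iff scaleR_conv_of_real[where 'a = complex])
  have z_A: "z (A *v v) = B *v z v" for v
    by (simp add: z_def B_def complex_matrix_def matrix_vector_mult_def vec_eq_iff)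
  \<comment> \<open>The Lyapunov function decays at rate \<open>\<mu> / 2\<close>, and the square
    root halves this. Using \<open>1 + K\<close> keeps the constant at least 1.\<close>
  have "norm (x s) \<le> sqrt (1 + K) * exp (- (\<mu> / 4) * (s - a)) * norm (x a)"
    if x: "solves_linear A a b x" and s: "s \<in> {a..<b}" for a b x s
  proof -
    define V where "V v = lyapunov B c ls (z v)" for v
    have "((\<lambda>r. V (x r)) has_real_derivative lyapunov_deriv B c ls (z (x r))) (at r within {a..<b})"
      if "r \<in> {a..<b}" for r
    proof -
      have "((\<lambda>r. z (x r)) has_vector_derivative z (A *v x r)) (at r within {a..<b})"
        using x that unfolding solves_linear_def
        by (intro bounded_linear.has_vector_derivative[OF z_linear]) auto
      then show ?thesis
        unfolding V_def by (intro lyapunov_has_real_derivative) (simp add: z_A)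
    qed
    moreover have "lyapunov_deriv B c ls (z (x r)) \<le> - (\<mu> / 2) * V (x r)" for r
    proof -
      have "lyapunov_deriv B c ls (z (x r)) \<le> - (\<mu> / 2) * (V (x r) + (norm (z (x r)))\<^sup>2)"
        unfolding c_def V_def using \<mu> ann by (intro lyapunov_deriv_le) auto
      also have "\<dots> \<le> - (\<mu> / 2) * V (x r)"
        using \<mu>(1) by (intro mult_left_mono_neg) auto
      finally show ?thesis .
    qed
    ultimately have decay: "V (x s) \<le> exp (- (\<mu> / 2) * (s - a)) * V (x a)"
      using s by (intro gronwall[of a b _ "\<lambda>r. lyapunov_deriv B c ls (z (x r))"]) auto
    have "(norm (x s))\<^sup>2 \<le> V (x s)"
      using norm_le_lyapunov[OF c ann, of "z (x s)"] by (simp add: V_def z_norm)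
    also note decay
    also have "exp (- (\<mu> / 2) * (s - a)) * V (x a) \<le> exp (- (\<mu> / 2) * (s - a)) * ((1 + K) * (norm (x a))\<^sup>2)"
    proof (intro mult_left_mono)
      show "V (x a) \<le> (1 + K) * (norm (x a))\<^sup>2"
        using K(2)[of "z (x a)"] by (simp add: V_def z_norm algebra_simps add_increasing)
    qed simp
    also have "\<dots> = (sqrt (1 + K) * exp (- (\<mu> / 4) * (s - a)) * norm (x a))\<^sup>2"
    proof -
      have "(exp (- (\<mu> / 4) * (s - a)))\<^sup>2 = exp (- (\<mu> / 2) * (s - a))"
        unfolding exp_double[symmetric] by simp
      then show ?thesis using K(1) by (simp add: power_mult_distrib)
    qed
    finally show ?thesis by (rule power2_le_imp_le) (use K(1) in simp)
  qed
  then show ?thesis using that[of "sqrt (1 + K)" "\<mu> / 4"] K \<mu> by simp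
qed

section \<open>The switched system\<close>

text \<open>Raising the constant and lowering the rate only weaken the bounds, so a maximum and a
  minimum serve finitely many subsystems at once.\<close>

lemma uniform_growth_and_decay:
  fixes A :: "'p \<Rightarrow> real ^ 'n ^ 'n"
  assumes "finite P"
  obtains C \<mu> where "C \<ge> 1" "\<mu> > 0"
    "\<And>p a b x s. p \<in> P \<Longrightarrow> solves_linear (A p) a b x \<Longrightarrow> s \<in> {a..<b} \<Longrightarrow> s - a \<le> 1 \<Longrightarrow>
       norm (x s) \<le> C * norm (x a)"
    "\<And>p a b x s. p \<in> P \<Longrightarrow> stable_matrix (A p) \<Longrightarrow> solves_linear (A p) a b x \<Longrightarrow> s \<in> {a..<b} \<Longrightarrow>
       norm (x s) \<le> C * exp (- \<mu> * (s - a)) * norm (x a)"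
proof -
  have "\<exists>C\<ge>1. \<exists>\<mu>>0. \<forall>p\<in>P.
    (\<forall>a b x s. solves_linear (A p) a b x \<longrightarrow> s \<in> {a..<b} \<longrightarrow> s - a \<le> 1 \<longrightarrow>
       norm (x s) \<le> C * norm (x a)) \<and>
    (\<forall>a b x s. stable_matrix (A p) \<longrightarrow> solves_linear (A p) a b x \<longrightarrow> s \<in> {a..<b} \<longrightarrow>
       norm (x s) \<le> C * exp (- \<mu> * (s - a)) * norm (x a))"
    (is "\<exists>C\<ge>1. \<exists>\<mu>>0. \<forall>p\<in>P. ?G C p \<and> ?D C \<mu> p")
    using assms
  proof induction
    case empty
    show ?case by (auto intro: exI[of _ 1])
  next
    case (insert p P)
    then obtain C \<mu> where C: "C \<ge> 1" "\<mu> > 0" "\<forall>p\<in>P. ?G C p \<and> ?D C \<mu> p" by auto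
    obtain C1 where C1: "C1 \<ge> 1" "?G C1 p"
      using linear_growth[of "A p"] by metis
    \<comment> \<open>If \<open>A p\<close> is not stable, the decay claim is vacuous and 1 serves
      as both constants.\<close>
    obtain C2 \<nu> where C2: "C2 \<ge> 1" "\<nu> > 0" "?D C2 \<nu> p"
      using stable_matrix_decay[of "A p"] by (metis zero_less_one order_refl)
    define C' where "C' = max C (max C1 C2)"
    define \<mu>' where "\<mu>' = min \<mu> \<nu>"
    have G: "?G C' q" if "?G c q" "c \<le> C'" for c q
    proof (intro allI impI)
      fix a b x s
      assume "solves_linear (A q) a b x" "s \<in> {a..<b}" "s - a \<le> 1"
      then have "norm (x s) \<le> c * norm (x a)" using that(1) by blast
      also have "\<dots> \<le> C' * norm (x a)" using that(2) by (intro mult_right_mono) auto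
      finally show "norm (x s) \<le> C' * norm (x a)" .
    qed
    have D: "?D C' \<mu>' q" if "?D c m q" "c \<ge> 1" "c \<le> C'" "\<mu>' \<le> m" for c m q
    proof (intro allI impI)
      fix a b x s
      assume *: "stable_matrix (A q)" "solves_linear (A q) a b x" "s \<in> {a..<b}"
      then have "norm (x s) \<le> c * exp (- m * (s - a)) * norm (x a)" using that(1) by blast
      also have "\<dots> \<le> C' * exp (- \<mu>' * (s - a)) * norm (x a)"
        using that(2-) * by (intro mult_right_mono mult_mono) (auto intro: mult_right_mono)
      finally show "norm (x s) \<le> C' * exp (- \<mu>' * (s - a)) * norm (x a)" .
    qed
    have le: "C \<le> C'" "C1 \<le> C'" "C2 \<le> C'" "\<mu>' \<le> \<mu>" "\<mu>' \<le> \<nu>"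
      by (auto simp: C'_def \<mu>'_def)
    have bounds: "?G C' q \<and> ?D C' \<mu>' q" if "q \<in> insert p P" for q
    proof (cases "q = p")
      case True
      then show ?thesis using G[OF C1(2) le(2)] D[OF C2(3,1) le(3,5)] by blast
    next
      case False
      then have "?G C q" "?D C \<mu> q" using that C(3) by auto
      then show ?thesis using G[OF _ le(1)] D[OF _ C(1) le(1,4)] by blast
    qed
    have "C' \<ge> 1" "\<mu>' > 0" using C C2 by (auto simp: C'_def \<mu>'_def)
    then show ?case
      by (intro exI[of _ C'] conjI[of "1 \<le> C'"] exI[of _ \<mu>'] conjI[of "0 < \<mu>'"] ballI bounds)
  qed
  then show ?thesis using that by metis
qed

section \<open>Impulse bounds, ranks of acyclic graphs and limits at switching times\<close>

lemma compact_matrix_bound: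
  fixes M :: "(real ^ 'n ^ 'm) set"
  assumes "compact M"
  obtains R where "R \<ge> 1" "\<And>J v. J \<in> M \<Longrightarrow> norm (J *v v) \<le> R * norm v"
proof -
  obtain b where b: "\<And>J. J \<in> M \<Longrightarrow> norm J \<le> b"
    using compact_imp_bounded[OF assms] by (auto simp: bounded_iff)
  define R where "R = max 1 (real CARD('m) * real CARD('n) * b)"
  have "norm (J *v v) \<le> R * norm v" if "J \<in> M" for J v
  proof -
    have "\<bar>J $ i $ j\<bar> \<le> b" for i j
      using b[OF that] component_le_norm_cart[of "J $ i" j]
        Finite_Cartesian_Product.norm_nth_le[of J i] by linarith
    then have "onorm ((*v) J) \<le> R"
      using onorm_le_matrix_component[of J b] by (simp add: R_def)
    then show ?thesis
      using onorm[OF matrix_vector_mul_bounded_linear[of J], of v]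
      by (meson mult_right_mono norm_ge_zero order_trans)
  qed
  then show ?thesis using that[of R] by (simp add: R_def)
qed

text \<open>The rank of a vertex counts the vertices reachable from it in at least one step. Along
  an edge to \<open>q\<close> this set shrinks strictly: it loses at least \<open>q\<close>, which
  acyclicity makes unreachable from itself.\<close>

lemma acyclic_rank:
  assumes "finite r" "acyclic r"
  obtains h :: "'a \<Rightarrow> nat" and N where "\<And>p. h p \<le> N" "\<And>p q. (p, q) \<in> r \<Longrightarrow> h q < h p"
proof
  let ?h = "\<lambda>p. card (r\<^sup>+ `` {p})"
  have fin: "finite (Range r)" using assms(1) by (rule finite_Range)
  have sub: "r\<^sup>+ `` {p} \<subseteq> Range r" for p
    by (metis Image_subset_eq Range.intros subsetI ImageE trancl_range)
  show "?h p \<le> card (Range r)" for p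
    by (rule card_mono[OF fin sub])
  show "?h q < ?h p" if "(p, q) \<in> r" for p q
  proof (rule psubset_card_mono)
    show "finite (r\<^sup>+ `` {p})" using sub fin by (rule finite_subset)
    have "q \<notin> r\<^sup>+ `` {q}" using assms(2) by (auto simp: acyclic_def)
    moreover have "q \<in> r\<^sup>+ `` {p}" using that by auto
    moreover have "r\<^sup>+ `` {q} \<subseteq> r\<^sup>+ `` {p}" using that by (auto intro: trancl_into_trancl2)
    ultimately show "r\<^sup>+ `` {q} \<subset> r\<^sup>+ `` {p}" by blast
  qed
qed

lemma unbounded_sequence_locate:
  fixes t :: "nat \<Rightarrow> real"
  assumes "filterlim t at_top sequentially" "t 0 \<le> s"
  obtains k where "t k \<le> s" "s < t (Suc k)"
proof -
  have "\<exists>n. s < t n"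
    using assms(1) unfolding filterlim_at_top_dense
    by (meson eventually_happens sequentially_bot)
  then have n: "s < t (LEAST n. s < t n)" by (rule LeastI_ex)
  with assms(2) obtain k where k: "(LEAST n. s < t n) = Suc k"
    by (metis not_less old.nat.exhaust)
  then have "\<not> s < t k" using not_less_Least[of k "\<lambda>n. s < t n"] by simp
  then show ?thesis using that[of k] n k by simp
qed

text \<open>Bounds along the flow hold strictly before a switching time, whereas the impulse acts on
  the left limit; this carries them over.\<close>

lemma norm_left_limit_le:
  fixes x :: "real \<Rightarrow> 'a::real_normed_vector"
  assumes lim: "(x \<longlongrightarrow> y) (at_left b)" and "a < b"
    and le: "\<And>s. s \<in> {a..<b} \<Longrightarrow> norm (x s) \<le> f s" and f: "(f \<longlongrightarrow> c) (at_left b)"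
  shows "norm y \<le> c"
proof (rule tendsto_le[OF _ f tendsto_norm[OF lim]])
  show "\<forall>\<^sub>F s in at_left b. norm (x s) \<le> f s"
    using eventually_at_left_real[OF assms(2)] by eventually_elim (auto intro: le)
qed simp

lemma stable_systemI:
  assumes "K \<ge> 0" "\<And>x s. trajectory A I \<sigma> t \<omega> x \<Longrightarrow> s > 0 \<Longrightarrow> norm (x s) \<le> K * norm (x 0)"
  shows "stable_system A I \<sigma> t \<omega>"
  unfolding stable_system_def
proof (intro allI impI)
  fix \<epsilon> :: real
  assume "\<epsilon> > 0"
  \<comment> \<open>Dividing by \<open>K + 1\<close> rather than by \<open>K\<close> covers the case
    \<open>K = 0\<close>.\<close>
  have "norm (x s) < \<epsilon>"
    if "trajectory A I \<sigma> t \<omega> x" "norm (x 0) < \<epsilon> / (K + 1)" "s > 0" for x s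
  proof -
    have "norm (x s) \<le> K * norm (x 0)" using assms(2) that by blast
    also have "\<dots> \<le> (K + 1) * norm (x 0)" by (simp add: algebra_simps)
    also have "\<dots> < \<epsilon>" using that(2) assms(1) by (simp add: field_simps)
    finally show ?thesis .
  qed
  moreover have "\<epsilon> / (K + 1) > 0" using \<open>\<epsilon> > 0\<close> assms(1) by simp
  ultimately show "\<exists>\<delta>>0. \<forall>x. trajectory A I \<sigma> t \<omega> x \<longrightarrow> norm (x 0) < \<delta> \<longrightarrow>
      (\<forall>s>0. norm (x s) < \<epsilon>)" by blast
qed

section \<open>Stability of the switched system\<close>

lemma trajectory_solves_linear:
  assumes "switching_signal P \<sigma> t" "trajectory A I \<sigma> t \<omega> x"
  shows "solves_linear (A (\<sigma> (t k))) (t k) (t (Suc k)) x"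
  unfolding solves_linear_def
proof
  fix s
  assume s: "s \<in> {t k..<t (Suc k)}"
  have "\<forall>k\<ge>1. \<forall>s\<in>{t (k - 1)..<t k}.
      (x has_vector_derivative A (\<sigma> s) *v x s) (at s within {t (k - 1)..<t k})"
    using assms(2) by (simp add: trajectory_def)
  from this[rule_format, of "Suc k"] s
  have "(x has_vector_derivative A (\<sigma> s) *v x s) (at s within {t k..<t (Suc k)})" by simp
  moreover have "\<sigma> s = \<sigma> (t k)" using assms(1) s by (auto simp: switching_signal_def)
  ultimately show "(x has_vector_derivative A (\<sigma> (t k)) *v x s) (at s within {t k..<t (Suc k)})"
    by simp
qed

theorem theorem3p10:
  fixes P :: "'p set"
    and A :: "'p \<Rightarrow> real ^ 'n ^ 'n"
    and E :: "('p \<times> 'p) set"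
    and M :: "(real ^ 'n ^ 'n) set"
  assumes "finite P"
    and "\<And>p. p \<in> P \<Longrightarrow> stable_matrix (A p) \<or> unstable_matrix (A p)"
    and "E \<subseteq> P \<times> P"
    and "\<And>p. p \<in> P \<Longrightarrow> \<exists>q. (p, q) \<in> E"
    and "acyclic (unstable_edges A E)"
    and "M \<noteq> {}" and "compact M" and "0 \<notin> M"
  shows "\<exists>\<tau>\<ge>0. \<exists>\<eta>>0. \<exists>(Q :: (real ^ 'n ^ 'n) set) (I :: real ^ 'n ^ 'n \<Rightarrow> real ^ 'n ^ 'n).
           Q \<noteq> {} \<and> I ` Q \<subseteq> M \<and> (\<forall>q\<in>Q. I q \<noteq> 0) \<and>
           (\<forall>(\<sigma>, t) \<in> signal_class P E A \<tau> \<eta>.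
              \<forall>\<omega> :: real \<Rightarrow> real ^ 'n ^ 'n.
                (\<forall>k\<ge>1. \<omega> (t k) \<in> Q) \<longrightarrow> stable_system A I \<sigma> t \<omega>)"
proof -
  obtain C \<mu> where C: "C \<ge> 1" "\<mu> > 0"
    and growth: "\<And>p a b x s. p \<in> P \<Longrightarrow> solves_linear (A p) a b x \<Longrightarrow> s \<in> {a..<b} \<Longrightarrow> s - a \<le> 1 \<Longrightarrow>
       norm (x s) \<le> C * norm (x a)"
    and decay: "\<And>p a b x s. p \<in> P \<Longrightarrow> stable_matrix (A p) \<Longrightarrow> solves_linear (A p) a b x \<Longrightarrow>
       s \<in> {a..<b} \<Longrightarrow> norm (x s) \<le> C * exp (- \<mu> * (s - a)) * norm (x a)"
    using uniform_growth_and_decay[OF assms(1), of A] by blast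
  obtain R where R: "R \<ge> 1" "\<And>J v. J \<in> M \<Longrightarrow> norm (J *v v) \<le> R * norm v"
    using compact_matrix_bound[OF assms(7)] by blast
  have "finite (unstable_edges A E)"
    using assms(1,3) by (auto intro: finite_subset[of _ "P \<times> P"] simp: unstable_edges_def)
  then obtain h :: "'p \<Rightarrow> nat" and N where h: "\<And>p. h p \<le> N"
      "\<And>p q. (p, q) \<in> unstable_edges A E \<Longrightarrow> h q < h p"
    using acyclic_rank[OF _ assms(5)] by blast
  \<comment> \<open>\<open>C\<close> bounds the flow over one period and \<open>R\<close> the
    impulse that ends it.\<close>
  define G where "G = R * C"
  have G: "G \<ge> 1" using mult_mono[OF R(1) C(1)] C(1) R(1) by (simp add: G_def)
  \<comment> \<open>chosen so that one stable period compensates for itself and for \<open>N\<close> unstable ones\<close>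
  define \<tau> where "\<tau> = real (Suc N) * ln G / \<mu>"
  have \<tau>: "\<tau> \<ge> 0" using G C by (simp add: \<tau>_def)
  \<comment> \<open>The factor \<open>G ^ N\<close> pays for the largest rise of the rank that can
    occur when a stable subsystem is left.\<close>
  have contract: "G * exp (- \<mu> * d) * G ^ N \<le> 1" if "d \<ge> \<tau>" for d
  proof -
    have "G ^ Suc N = exp (\<mu> * \<tau>)"
      using G C by (simp add: \<tau>_def exp_of_nat_mult del: of_nat_Suc power_Suc)
    then have "G * exp (- \<mu> * d) * G ^ N = exp (\<mu> * \<tau> - \<mu> * d)"
      by (simp add: exp_diff exp_minus field_simps)
    then show ?thesis using that C by simp
  qed
  \<comment> \<open>The impulses are indexed by themselves through \<open>id\<close>. The bound 1 on
    unstable periods is the time span for which \<open>growth\<close> holds.\<close>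
  have stable: "stable_system A id \<sigma> t \<omega>"
    if sig: "(\<sigma>, t) \<in> signal_class P E A \<tau> 1" and \<omega>: "\<forall>k\<ge>1. \<omega> (t k) \<in> M" for \<sigma> t \<omega>
  proof (rule stable_systemI)
    show "C * G ^ N \<ge> 0" using C G by simp
    fix x and s :: real
    assume x: "trajectory A id \<sigma> t \<omega> x" and "s > 0"
    have sw: "switching_signal P \<sigma> t" and adm: "graph_admissible E \<sigma> t"
      using sig by (auto simp: signal_class_def)
    then have t: "t 0 = 0" "strict_mono t" "filterlim t at_top sequentially"
      by (auto simp: switching_signal_def)
    have mem: "\<sigma> (t k) \<in> P" for k
      using sw t(1) strict_mono_less_eq[OF t(2), of 0 k] by (auto simp: switching_signal_def)
    have less: "t k < t (Suc k)" for k
      using t(2) by (simp add: strict_mono_less)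
    have dwell: "t (Suc k) - t k \<ge> \<tau>" if "stable_matrix (A (\<sigma> (t k)))" for k
      using sig that unfolding signal_class_def by (auto dest!: spec[of _ "Suc k"])
    have brief: "t (Suc k) - t k \<le> 1" if "unstable_matrix (A (\<sigma> (t k)))" for k
      using sig that unfolding signal_class_def by (auto dest!: spec[of _ "Suc k"])
    have edge: "(\<sigma> (t k), \<sigma> (t (Suc k))) \<in> E" for k
      using adm unfolding graph_admissible_def by (auto dest!: spec[of _ "Suc k"])
    note sol = trajectory_solves_linear[OF sw x]
    have inter: "norm (x r) \<le> C * norm (x (t k))" if r: "r \<in> {t k..<t (Suc k)}" for k r
      using assms(2)[OF mem[of k]]
    proof
      assume "stable_matrix (A (\<sigma> (t k)))"
      then have "norm (x r) \<le> C * exp (- \<mu> * (r - t k)) * norm (x (t k))"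
        using decay mem sol r by blast
      also have "\<dots> \<le> C * 1 * norm (x (t k))"
        using C r by (intro mult_right_mono mult_left_mono) auto
      finally show ?thesis by simp
    next
      assume "unstable_matrix (A (\<sigma> (t k)))"
      then have "r - t k \<le> 1" using brief[of k] r by auto
      then show ?thesis using growth mem sol r by blast
    qed
    have jump: "\<exists>y. (x \<longlongrightarrow> y) (at_left (t (Suc k))) \<and> norm (x (t (Suc k))) \<le> R * norm y" for k
      using x \<omega> R(2) unfolding trajectory_def by (metis id_apply le_add1 plus_1_eq_Suc)
    \<comment> \<open>The weight holds one factor \<open>G\<close> in reserve for each unstable
      period that can follow in an unbroken run, since the rank drops at every such switch.\<close>
    define \<Phi> where "\<Phi> k = norm (x (t k)) * G ^ h (\<sigma> (t k))" for k
    have norm_le_\<Phi>: "norm (x (t k)) \<le> \<Phi> k" for k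
      using mult_left_mono[OF one_le_power[OF G], of "norm (x (t k))"] by (simp add: \<Phi>_def)
    have step: "\<Phi> (Suc k) \<le> \<Phi> k" for k
    proof -
      obtain y where y: "(x \<longlongrightarrow> y) (at_left (t (Suc k)))" "norm (x (t (Suc k))) \<le> R * norm y"
        using jump by blast
      show ?thesis
        using assms(2)[OF mem[of k]]
      proof
        assume st: "stable_matrix (A (\<sigma> (t k)))"
        define d where "d = t (Suc k) - t k"
        have "norm y \<le> C * exp (- \<mu> * d) * norm (x (t k))"
          unfolding d_def
        proof (rule norm_left_limit_le[OF y(1) less])
          show "norm (x r) \<le> C * exp (- \<mu> * (r - t k)) * norm (x (t k))"
            if "r \<in> {t k..<t (Suc k)}" for r
            using decay mem sol st that by blast
        qed (intro tendsto_intros)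
        then have "R * norm y \<le> R * (C * exp (- \<mu> * d) * norm (x (t k)))"
          using R(1) by (intro mult_left_mono) auto
        with y(2) have "norm (x (t (Suc k))) \<le> G * exp (- \<mu> * d) * norm (x (t k))"
          by (simp add: G_def mult.assoc)
        \<comment> \<open>Nothing relates the new rank to the old one here, so it is bounded by
          \<open>N\<close>.\<close>
        then have "\<Phi> (Suc k) \<le> (G * exp (- \<mu> * d) * norm (x (t k))) * G ^ N"
          unfolding \<Phi>_def using G h(1) by (intro mult_mono power_increasing) auto
        also have "\<dots> = (G * exp (- \<mu> * d) * G ^ N) * norm (x (t k))" by simp
        also have "\<dots> \<le> 1 * norm (x (t k))"
          using dwell[OF st] by (intro mult_right_mono contract) (auto simp: d_def)
        also have "\<dots> \<le> \<Phi> k"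
          using norm_le_\<Phi> by simp
        finally show ?thesis .
      next
        assume un: "unstable_matrix (A (\<sigma> (t k)))"
        have "norm y \<le> C * norm (x (t k))"
          using norm_left_limit_le[OF y(1) less inter tendsto_const] .
        then have "R * norm y \<le> R * (C * norm (x (t k)))"
          using R(1) by (intro mult_left_mono) auto
        with y(2) have "norm (x (t (Suc k))) \<le> G * norm (x (t k))"
          by (simp add: G_def mult.assoc)
        then have "\<Phi> (Suc k) \<le> (G * norm (x (t k))) * G ^ h (\<sigma> (t (Suc k)))"
          unfolding \<Phi>_def using G by (intro mult_right_mono) auto
        \<comment> \<open>The growth factor \<open>G\<close> is merged into the weight; the strict
          drop of the rank along an unstable edge absorbs the added exponent.\<close>
        also have "\<dots> = norm (x (t k)) * G ^ Suc (h (\<sigma> (t (Suc k))))" by simp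
        also have "\<dots> \<le> \<Phi> k"
        proof -
          have "(\<sigma> (t k), \<sigma> (t (Suc k))) \<in> unstable_edges A E"
            using un edge[of k] by (simp add: unstable_edges_def)
          from h(2)[OF this] show ?thesis
            unfolding \<Phi>_def using G by (intro mult_left_mono power_increasing) auto
        qed
        finally show ?thesis .
      qed
    qed
    \<comment> \<open>The potential controls the switching times only; one further factor
      \<open>C\<close> covers the interval that contains \<open>s\<close>.\<close>
    obtain k where k: "t k \<le> s" "s < t (Suc k)"
      using unbounded_sequence_locate[OF t(3), of s] t(1) \<open>s > 0\<close> by auto
    note norm_le_\<Phi>[of k]
    also have "\<Phi> k \<le> \<Phi> 0" using lift_Suc_antimono_le[of \<Phi>] step by simp
    also have "\<dots> \<le> norm (x 0) * G ^ N"
      unfolding \<Phi>_def using G h(1) t(1) by (auto intro!: mult_left_mono power_increasing)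
    finally have "C * norm (x (t k)) \<le> C * (norm (x 0) * G ^ N)"
      using C by (intro mult_left_mono) auto
    then show "norm (x s) \<le> C * G ^ N * norm (x 0)"
      using inter[of s k] k by (simp add: mult_ac)
  qed
  have "M \<noteq> {} \<and> id ` M \<subseteq> M \<and> (\<forall>q\<in>M. id q \<noteq> (0 :: real ^ 'n ^ 'n)) \<and>
      (\<forall>(\<sigma>, t) \<in> signal_class P E A \<tau> 1. \<forall>\<omega>. (\<forall>k\<ge>1. \<omega> (t k) \<in> M) \<longrightarrow> stable_system A id \<sigma> t \<omega>)"
    using assms(6,8) stable by auto
  with \<tau> zero_less_one show ?thesis by blast
qed

end
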